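(* Let $D\subseteq\mathbb{C}$ be a domain, let $m\in\mathbb{N}$, let $\mathcal{R}$ be a family of rational functions of degree at most $m$, and let $\mathcal{G}$ be a family of meromorphic functions on $D$. Let $a_1,a_2,a_3\in\mathbb{C}_\infty$ be three distinct values. If $\mathcal{G}$ is normal in $D$ and for each $R\in\mathcal{R}$ there exists $g\in\mathcal{G}$ such that $R$ and $g$ share $a_j$ partially in $D$ for each $j=1,2,3$, then $\mathcal{R}$ is normal in $D$.
   Context: $\mathbb{C}_\infty=\mathbb{C}\cup\{\infty\}$ is the extended complex plane. Rational functions are regarded as meromorphic functions on $D$ by restriction. A family of meromorphic functions on $D$ is normal in $D$ if every sequence in the family has a subsequence converging spherically locally uniformly in $D$; the limit is either a meromorphic function on $D$ or identically equal to $\infty$. For a meromorphic function $f$ on $D$ and $a\in\mathbb{C}_\infty$, $\bar{E}(f,a)=\{z\in D: f(z)=a\}$ (multiplicities ignored). Two meromorphic functions $f,g$ on $D$ are said to share $a$ partially in $D$ if $\bar{E}(f,a)\subseteq\bar{E}(g,a)$ (in this order: every $a$-point of $f$ in $D$ is an $a$-point of $g$). *)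

theory Defs
  imports "HOL-Complex_Analysis.Complex_Analysis"
begin

text \<open>
  The extended complex plane as a metric space. Spherical convergence is measured with the chordal
  metric, i.e. the Euclidean distance of the stereographic projections to the unit sphere of
  \<open>complex \<times> real\<close>; see \<open>dist_riemann_sphere\<close> below for the explicit formulas. The great-circle
  metric is uniformly equivalent to it and hence yields the same uniform convergence.
\<close>

datatype riemann_sphere = Fin complex | Infty

fun stereo :: "riemann_sphere \<Rightarrow> complex \<times> real" where
  "stereo (Fin z) = ((2 / (1 + (cmod z)\<^sup>2)) *\<^sub>R z, ((cmod z)\<^sup>2 - 1) / (1 + (cmod z)\<^sup>2))"
| "stereo Infty = (0, 1)"

lemma one_plus_norm_sq_pos: "1 + (cmod z)\<^sup>2 > 0"
  by (simp add: add_pos_nonneg)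

lemma stereo_Fin_snd_neq_1: "((cmod z)\<^sup>2 - 1) / (1 + (cmod z)\<^sup>2) \<noteq> 1"
  using one_plus_norm_sq_pos[of z] by (simp add: divide_eq_eq)

lemma stereo_Fin_inject: "stereo (Fin z) = stereo (Fin w) \<Longrightarrow> z = w"
proof -
  assume eq: "stereo (Fin z) = stereo (Fin w)"
  have "((cmod z)\<^sup>2 - 1) / (1 + (cmod z)\<^sup>2) = ((cmod w)\<^sup>2 - 1) / (1 + (cmod w)\<^sup>2)"
    using eq by simp
  hence "(cmod z)\<^sup>2 = (cmod w)\<^sup>2"
    using one_plus_norm_sq_pos[of z] one_plus_norm_sq_pos[of w] by (simp add: frac_eq_eq algebra_simps)
  thus "z = w"
    using eq one_plus_norm_sq_pos[of w] by simp
qed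

lemma inj_stereo: "inj stereo"
proof (rule injI)
  fix x y assume "stereo x = stereo y"
  thus "x = y"
    using stereo_Fin_snd_neq_1 stereo_Fin_inject
    by (cases x; cases y) (auto simp del: stereo.simps(1) simp add: stereo.simps(1)[THEN arg_cong[where f = snd]]
          dest: arg_cong[where f = snd])
qed

instantiation riemann_sphere :: metric_space
begin

definition dist_riemann_sphere :: "riemann_sphere \<Rightarrow> riemann_sphere \<Rightarrow> real" where
  "dist_riemann_sphere x y = dist (stereo x) (stereo y)"

definition uniformity_riemann_sphere :: "(riemann_sphere \<times> riemann_sphere) filter" where
  "uniformity_riemann_sphere = (INF e\<in>{0<..}. principal {(x, y). dist x y < e})"

definition open_riemann_sphere :: "riemann_sphere set \<Rightarrow> bool" where
  "open_riemann_sphere U \<longleftrightarrow> (\<forall>x\<in>U. \<forall>\<^sub>F (x', y) in uniformity. x' = x \<longrightarrow> y \<in> U)"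

instance
proof
  fix x y z :: riemann_sphere
  show "dist x y = 0 \<longleftrightarrow> x = y"
    using inj_stereo by (auto simp: dist_riemann_sphere_def dest: injD)
  show "dist x y \<le> dist x z + dist y z"
    unfolding dist_riemann_sphere_def by (rule dist_triangle2)
qed (simp_all add: uniformity_riemann_sphere_def open_riemann_sphere_def)

end

lemma dist_riemann_sphere:
  "dist (Fin z) (Fin w) = 2 * cmod (z - w) / (sqrt (1 + (cmod z)\<^sup>2) * sqrt (1 + (cmod w)\<^sup>2))"
  "dist (Fin z) Infty = 2 / sqrt (1 + (cmod z)\<^sup>2)"
  "dist Infty (Fin z) = 2 / sqrt (1 + (cmod z)\<^sup>2)"
proof -
  define A where "A = 1 + (cmod z)\<^sup>2"
  define B where "B = 1 + (cmod w)\<^sup>2"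
  have AB: "A > 0" "B > 0" by (auto simp: A_def B_def one_plus_norm_sq_pos)
  have *: "(cmod (s *\<^sub>R z - t *\<^sub>R w))\<^sup>2 + (t - s)\<^sup>2
      = s\<^sup>2 * A + t\<^sup>2 * B - 2 * s * t * (1 + Re z * Re w + Im z * Im w)" for s t
    unfolding A_def B_def cmod_power2 by (simp add: algebra_simps power2_eq_square)
  have "(dist (stereo (Fin z)) (stereo (Fin w)))\<^sup>2
      = (cmod ((2 / A) *\<^sub>R z - (2 / B) *\<^sub>R w))\<^sup>2 + ((A - 2) / A - (B - 2) / B)\<^sup>2"
    by (simp add: dist_Pair_Pair dist_real_def dist_norm[where 'a = complex] A_def B_def)
  also have "(A - 2) / A - (B - 2) / B = 2 / B - 2 / A"
    using AB by (simp add: field_simps)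
  also have "(cmod ((2 / A) *\<^sub>R z - (2 / B) *\<^sub>R w))\<^sup>2 + (2 / B - 2 / A)\<^sup>2
      = (2 / A)\<^sup>2 * A + (2 / B)\<^sup>2 * B - 2 * (2 / A) * (2 / B) * (1 + Re z * Re w + Im z * Im w)"
    by (rule *)
  also have "\<dots> = 4 / (A * B) * (A + B - 2 * (1 + Re z * Re w + Im z * Im w))"
    using AB by (simp add: field_simps power2_eq_square)
  also have "A + B - 2 * (1 + Re z * Re w + Im z * Im w) = (cmod (z - w))\<^sup>2"
    unfolding A_def B_def cmod_power2 by (simp add: algebra_simps power2_eq_square)
  also have "4 / (A * B) * (cmod (z - w))\<^sup>2 = (2 * cmod (z - w) / (sqrt A * sqrt B))\<^sup>2"
    using AB by (simp add: power_divide power_mult_distrib)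
  finally show "dist (Fin z) (Fin w) = 2 * cmod (z - w) / (sqrt (1 + (cmod z)\<^sup>2) * sqrt (1 + (cmod w)\<^sup>2))"
    unfolding dist_riemann_sphere_def A_def B_def by (subst (asm) power2_eq_iff_nonneg) auto
next
  define A where "A = 1 + (cmod z)\<^sup>2"
  have A: "A > 0" by (auto simp: A_def one_plus_norm_sq_pos)
  have "(dist (stereo (Fin z)) (stereo Infty))\<^sup>2 = (cmod ((2 / A) *\<^sub>R z))\<^sup>2 + ((A - 2) / A - 1)\<^sup>2"
    by (simp add: dist_Pair_Pair dist_real_def dist_norm[where 'a = complex] A_def)
  also have "(A - 2) / A - 1 = - 2 / A"
    using A by (simp add: field_simps)
  also have "(cmod ((2 / A) *\<^sub>R z))\<^sup>2 + (- 2 / A)\<^sup>2 = (2 / A)\<^sup>2 * A"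
    by (simp add: A_def power_mult_distrib power_divide algebra_simps add_divide_distrib)
  also have "\<dots> = (2 / sqrt A)\<^sup>2"
    using A by (simp add: field_simps power2_eq_square)
  finally show *: "dist (Fin z) Infty = 2 / sqrt (1 + (cmod z)\<^sup>2)"
    using A unfolding dist_riemann_sphere_def A_def by (subst (asm) power2_eq_iff_nonneg) auto
  show "dist Infty (Fin z) = 2 / sqrt (1 + (cmod z)\<^sup>2)"
    using * by (simp add: dist_commute)
qed

text \<open>
  Meromorphic functions on \<open>D\<close> are functions that are \<open>nicely_meromorphic_on D\<close>: these have the
  dummy value \<open>0\<close> at poles and are analytic elsewhere. The following map recovers the genuine value
  in the extended plane.
\<close>

definition sphere_val :: "(complex \<Rightarrow> complex) \<Rightarrow> complex \<Rightarrow> riemann_sphere" where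
  "sphere_val f z = (if is_pole f z then Infty else Fin (f z))"

definition shares_partially ::
    "complex set \<Rightarrow> (complex \<Rightarrow> complex) \<Rightarrow> (complex \<Rightarrow> complex) \<Rightarrow> riemann_sphere \<Rightarrow> bool" where
  "shares_partially D f g a \<longleftrightarrow> {z \<in> D. sphere_val f z = a} \<subseteq> {z \<in> D. sphere_val g z = a}"

definition spherically_locally_uniform_limit ::
    "complex set \<Rightarrow> (nat \<Rightarrow> complex \<Rightarrow> complex) \<Rightarrow> (complex \<Rightarrow> riemann_sphere) \<Rightarrow> bool" where
  "spherically_locally_uniform_limit D f L \<longleftrightarrow>
     (\<forall>z\<in>D. \<exists>U. open U \<and> z \<in> U \<and> uniform_limit (U \<inter> D) (\<lambda>n. sphere_val (f n)) L sequentially)"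

definition normal_family :: "complex set \<Rightarrow> (complex \<Rightarrow> complex) set \<Rightarrow> bool" where
  "normal_family D \<F> \<longleftrightarrow>
     (\<forall>f :: nat \<Rightarrow> complex \<Rightarrow> complex. range f \<subseteq> \<F> \<longrightarrow>
        (\<exists>r L. strict_mono (r :: nat \<Rightarrow> nat) \<and>
               spherically_locally_uniform_limit D (f \<circ> r) L \<and>
               ((\<exists>h. h nicely_meromorphic_on D \<and> (\<forall>z\<in>D. L z = sphere_val h z)) \<or>
                (\<forall>z\<in>D. L z = Infty))))"

text \<open>
  Coprimality makes the degree well defined, and (as division by zero gives \<open>0\<close>) it makes the
  quotient nicely meromorphic, see
  \<open>rational_fun_nicely_meromorphic\<close> and \<open>sphere_val_rational\<close>.
\<close>

definition rational_fun :: "nat \<Rightarrow> (complex \<Rightarrow> complex) \<Rightarrow> bool" where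
  "rational_fun d R \<longleftrightarrow>
     (\<exists>p q. q \<noteq> 0 \<and> coprime p q \<and> d = max (degree p) (degree q) \<and> R = (\<lambda>z. poly p z / poly q z))"

lemma is_pole_rational:
  fixes p q :: "complex poly"
  assumes q: "q \<noteq> 0" and cop: "coprime p q" and z: "poly q z = 0"
  shows "is_pole (\<lambda>z. poly p z / poly q z) z"
proof -
  have pz: "poly p z \<noteq> 0"
    using coprime_poly_0[OF cop, of z] z by simp
  have "open (- ({w. poly q w = 0} - {z}))"
    using poly_roots_finite[OF q] by (intro open_Compl finite_imp_closed) auto
  hence "\<forall>\<^sub>F w in at z. w \<in> - ({w. poly q w = 0} - {z}) - {z}"
    by (intro eventually_at_in_open) auto
  hence "\<forall>\<^sub>F w in at z. poly q w \<noteq> 0"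
    by eventually_elim auto
  moreover have "poly q \<midarrow>z\<rightarrow> 0"
    using tendsto_poly[OF tendsto_ident_at, of q z UNIV] z by simp
  ultimately have "filterlim (poly q) (at 0) (at z)"
    by (simp add: filterlim_at)
  moreover have "poly p \<midarrow>z\<rightarrow> poly p z"
    by (intro tendsto_poly tendsto_ident_at)
  ultimately show ?thesis
    unfolding is_pole_def using pz by (intro filterlim_divide_at_infinity)
qed

lemma poly_analytic_on: "poly p analytic_on A" for p :: "complex poly"
  by (simp add: analytic_on_holomorphic) (auto intro!: holomorphic_intros)

lemma isCont_rational:
  fixes p q :: "complex poly"
  shows "poly q z \<noteq> 0 \<Longrightarrow> isCont (\<lambda>z. poly p z / poly q z) z"
  by (intro continuous_intros) auto

lemma rational_fun_nicely_meromorphic: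
  assumes "rational_fun d R"
  shows "R nicely_meromorphic_on D"
proof -
  obtain p q where q: "q \<noteq> 0" and cop: "coprime p q" and R: "R = (\<lambda>z. poly p z / poly q z)"
    using assms by (auto simp: rational_fun_def)
  have "R meromorphic_on D"
    unfolding R by (intro meromorphic_on_divide analytic_on_imp_meromorphic_on poly_analytic_on)
  moreover have "(is_pole R z \<and> R z = 0) \<or> R \<midarrow>z\<rightarrow> R z" for z
    using is_pole_rational[OF q cop, of z] isCont_rational[of q z p]
    by (cases "poly q z = 0") (simp_all add: R isCont_def)
  ultimately show ?thesis
    by (auto simp: nicely_meromorphic_on_def)
qed

lemma sphere_val_rational:
  assumes "q \<noteq> 0" "coprime p q"
  shows "sphere_val (\<lambda>z. poly p z / poly q z) z =
           (if poly q z = 0 then Infty else Fin (poly p z / poly q z))"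
proof (cases "poly q z = 0")
  case True
  thus ?thesis using is_pole_rational[OF assms] by (simp add: sphere_val_def)
next
  case False
  have "\<not> is_pole (\<lambda>z. poly p z / poly q z) z"
    using isCont_rational[OF False, of p] not_tendsto_and_filterlim_at_infinity[of "at z"]
    unfolding is_pole_def isCont_def by auto
  thus ?thesis using False by (simp add: sphere_val_def)
qed

end

theory Submission
  imports Defs "HOL-Computational_Algebra.Field_as_Ring"
    "HOL-Computational_Algebra.Polynomial_Factorial"
begin

text \<open>
  Write \<open>R\<^sub>n = p\<^sub>n / q\<^sub>n\<close> in lowest terms, scaled so that the moduli of all coefficients add up to \<open>1\<close>.
  Boundedness of the degree gives a subsequence along which \<open>p\<^sub>n \<rightarrow> P\<close> and \<open>q\<^sub>n \<rightarrow> Q\<close> coefficientwise,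
  with \<open>P\<close>, \<open>Q\<close> not both zero, and \<open>R\<^sub>n\<close> then converges to \<open>P / Q\<close> away from the common zeros of \<open>P\<close> and
  \<open>Q\<close>. There are no common zeros in \<open>D\<close>: the limit of the associated \<open>g\<^sub>n\<close> differs at \<open>z\<^sub>0\<close> from at least
  two of the \<open>a\<^sub>j\<close>, so \<open>g\<^sub>n\<close> and hence \<open>R\<^sub>n\<close> omits two values near \<open>z\<^sub>0\<close>. Each omitted value is a linear
  combination of \<open>p\<^sub>n\<close> and \<open>q\<^sub>n\<close> without zeros near \<open>z\<^sub>0\<close>; if \<open>P\<close> and \<open>Q\<close> both vanished at \<open>z\<^sub>0\<close>, Hurwitz'
  theorem would make two independent combinations of \<open>P\<close> and \<open>Q\<close> vanish identically.
\<close>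

section \<open>Homogeneous coordinates and the chordal metric\<close>

text \<open>The point of the sphere with homogeneous coordinates \<open>(u, v)\<close>; the value at \<open>(0, 0)\<close> is junk.\<close>
definition ratio :: "complex \<Rightarrow> complex \<Rightarrow> riemann_sphere" where
  "ratio u v = (if v = 0 then Infty else Fin (u / v))"

text \<open>The right-hand side is invariant under scaling either pair, so it treats
  \<open>Infty\<close> like any other point and later estimates need no change of chart at poles.
  The cases on \<open>v\<close> and \<open>v'\<close> match the chart formulas of
  \<open>dist_riemann_sphere\<close>.\<close>

lemma dist_ratio:
  assumes "u \<noteq> 0 \<or> v \<noteq> 0" "u' \<noteq> 0 \<or> v' \<noteq> 0"
  shows "dist (ratio u v) (ratio u' v') = 2 * cmod (u * v' - u' * v) / (norm (u, v) * norm (u', v'))"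
proof -
  have chart: "sqrt (1 + (cmod (x / y))\<^sup>2) = norm (x, y) / cmod y" if "y \<noteq> 0" for x y
  proof -
    have "1 + (cmod (x / y))\<^sup>2 = ((cmod x)\<^sup>2 + (cmod y)\<^sup>2) / (cmod y)\<^sup>2"
      using that by (simp add: norm_divide field_simps)
    then show ?thesis
      by (simp add: norm_Pair real_sqrt_divide)
  qed
  have diff: "cmod (u / v - u' / v') = cmod (u * v' - u' * v) / (cmod v * cmod v')"
    if "v \<noteq> 0" "v' \<noteq> 0"
    using that by (simp add: diff_frac_eq norm_divide norm_mult)
  consider "v = 0" "v' = 0" | "v = 0" "v' \<noteq> 0" | "v \<noteq> 0" "v' = 0" | "v \<noteq> 0" "v' \<noteq> 0"
    by blast
  then show ?thesis
  proof cases
    case 4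
    then show ?thesis
      by (simp add: ratio_def dist_riemann_sphere chart diff)
  qed (use assms in \<open>auto simp: ratio_def dist_riemann_sphere chart norm_mult\<close>)
qed

text \<open>The determinant is bounded by \<open>norm (u, v)\<close> times the coordinate errors,
  and that norm cancels. Hence only the limit pair \<open>(u', v')\<close> has to stay away from the
  origin.\<close>

lemma dist_ratio_le:
  assumes "u \<noteq> 0 \<or> v \<noteq> 0" "u' \<noteq> 0 \<or> v' \<noteq> 0"
  shows "dist (ratio u v) (ratio u' v') \<le> 2 * (dist u u' + dist v v') / norm (u', v')"
proof -
  have pos: "norm (u, v) > 0" "norm (u', v') > 0"
    using assms by (auto simp: zero_prod_def)
  have le: "cmod u \<le> norm (u, v)" "cmod v \<le> norm (u, v)"
    by (auto intro: real_le_rsqrt simp: norm_Pair)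
  have "cmod (u * v' - u' * v) = cmod ((u - u') * v - u * (v - v'))"
    by (simp add: algebra_simps)
  also have "\<dots> \<le> dist u u' * cmod v + cmod u * dist v v'"
    by (metis dist_norm norm_mult norm_triangle_ineq4)
  also have "\<dots> \<le> dist u u' * norm (u, v) + norm (u, v) * dist v v'"
    using le by (intro add_mono mult_mono) auto
  finally have "cmod (u * v' - u' * v) \<le> norm (u, v) * (dist u u' + dist v v')"
    by (simp add: algebra_simps)
  then have "2 * cmod (u * v' - u' * v) / (norm (u, v) * norm (u', v'))
      \<le> 2 * (norm (u, v) * (dist u u' + dist v v')) / (norm (u, v) * norm (u', v'))"
    using pos by (intro divide_right_mono mult_left_mono) auto
  also have "\<dots> = 2 * (dist u u' + dist v v') / norm (u', v')"
    using pos by simp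
  finally show ?thesis
    by (simp add: dist_ratio[OF assms])
qed

section \<open>Linear forms cutting out the points of a given value\<close>

fun omission_poly :: "riemann_sphere \<Rightarrow> complex poly \<Rightarrow> complex poly \<Rightarrow> complex poly" where
  "omission_poly (Fin w) p q = p - smult w q"
| "omission_poly Infty p q = q"

lemma ratio_eq_iff_omission_poly:
  assumes "poly p z \<noteq> 0 \<or> poly q z \<noteq> 0"
  shows "ratio (poly p z) (poly q z) = a \<longleftrightarrow> poly (omission_poly a p q) z = 0"
  using assms by (cases a) (auto simp: ratio_def field_simps)

text \<open>The linear forms in \<open>p\<close> and \<open>q\<close> belonging to two different
  points of the sphere are linearly independent.\<close>

lemma omission_poly_zero_imp:
  assumes "a \<noteq> b" "omission_poly a p q = 0" "omission_poly b p q = 0"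
  shows "p = 0 \<and> q = 0"
proof (cases a)
  case (Fin w)
  show ?thesis
  proof (cases b)
    case (Fin w')
    have "p = smult w q" "p = smult w' q"
      using assms \<open>a = Fin w\<close> Fin by auto
    then have "smult (w - w') q = 0"
      by (simp add: smult_diff_left)
    then show ?thesis
      using assms \<open>a = Fin w\<close> Fin \<open>p = smult w q\<close> by auto
  qed (use assms Fin in auto)
next
  case Infty
  then show ?thesis
    using assms by (cases b) auto
qed

lemma degree_omission_poly_le:
  "degree p \<le> m \<Longrightarrow> degree q \<le> m \<Longrightarrow> degree (omission_poly a p q) \<le> m"
  by (cases a) (auto intro!: degree_diff_le order_trans[OF degree_smult_le])

lemma tendsto_coeff_omission_poly:
  assumes "\<And>i. (\<lambda>n. coeff (p n) i) \<longlonglongrightarrow> coeff P i" "\<And>i. (\<lambda>n. coeff (q n) i) \<longlonglongrightarrow> coeff Q i"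
  shows "(\<lambda>n. coeff (omission_poly a (p n) (q n)) i) \<longlonglongrightarrow> coeff (omission_poly a P Q) i"
  using assms by (cases a) (auto intro!: tendsto_intros)

section \<open>Coefficientwise limits of polynomials of bounded degree\<close>

lemma poly_eq_sum_atMost:
  fixes p :: "'a::comm_ring_1 poly"
  assumes "degree p \<le> m"
  shows "poly p z = (\<Sum>i\<le>m. coeff p i * z ^ i)"
  by (subst poly_as_sum_of_monoms'[OF assms, symmetric]) (simp add: poly_sum poly_monom)

lemma uniform_limit_poly:
  fixes p :: "nat \<Rightarrow> complex poly"
  assumes p: "\<And>n. degree (p n) \<le> m" and P: "degree P \<le> m"
    and lim: "\<And>i. (\<lambda>n. coeff (p n) i) \<longlonglongrightarrow> coeff P i"
    and K: "bounded K"
  shows "uniform_limit K (\<lambda>n. poly (p n)) (poly P) sequentially"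
proof -
  obtain B where B: "B > 0" "\<And>z. z \<in> K \<Longrightarrow> cmod z \<le> B"
    using K bounded_pos by blast
  \<comment> \<open>The common degree bound leaves finitely many terms, so \<open>E n\<close> tends
    to 0 and bounds the error on all of \<open>K\<close> at once.\<close>
  define E where "E n = (\<Sum>i\<le>m. cmod (coeff (p n) i - coeff P i) * B ^ i)" for n
  have "E \<longlonglongrightarrow> (\<Sum>i\<le>m. cmod (coeff P i - coeff P i) * B ^ i)"
    unfolding E_def by (intro tendsto_intros lim)
  then have E: "E \<longlonglongrightarrow> 0"
    by simp
  have le: "dist (poly (p n) z) (poly P z) \<le> E n" if "z \<in> K" for n z
  proof -
    have "poly (p n) z - poly P z = (\<Sum>i\<le>m. (coeff (p n) i - coeff P i) * z ^ i)"
      by (simp add: poly_eq_sum_atMost[OF p] poly_eq_sum_atMost[OF P] algebra_simps sum_subtractf)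
    also have "cmod \<dots> \<le> (\<Sum>i\<le>m. cmod (coeff (p n) i - coeff P i) * cmod z ^ i)"
      by (rule order_trans[OF norm_sum]) (simp add: norm_mult norm_power)
    also have "\<dots> \<le> E n"
      unfolding E_def by (intro sum_mono mult_left_mono power_mono B that) auto
    finally show ?thesis
      by (simp add: dist_norm)
  qed
  show ?thesis
  proof (rule uniform_limitI)
    fix e :: real assume "e > 0"
    with E have "\<forall>\<^sub>F n in sequentially. E n < e"
      by (rule order_tendstoD)
    then show "\<forall>\<^sub>F n in sequentially. \<forall>z\<in>K. dist (poly (p n) z) (poly P z) < e"
      by eventually_elim (use le in \<open>auto intro: le_less_trans\<close>)
  qed
qed

lemma Hurwitz_poly:
  fixes p :: "nat \<Rightarrow> complex poly"
  assumes p: "\<And>n. degree (p n) \<le> m" and P: "degree P \<le> m"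
    and lim: "\<And>i. (\<lambda>n. coeff (p n) i) \<longlonglongrightarrow> coeff P i"
    and nz: "\<forall>\<^sub>F n in sequentially. \<forall>z\<in>ball z0 r. poly (p n) z \<noteq> 0"
    and r: "r > 0" and zero: "poly P z0 = 0"
  shows "P = 0"
proof (rule ccontr)
  assume "P \<noteq> 0"
  \<comment> \<open>\<open>Hurwitz_no_zeros\<close> wants every member of the sequence to be free of
    zeros, so the sequence is shifted by \<open>N\<close>.\<close>
  obtain N where N: "\<And>n z. n \<ge> N \<Longrightarrow> z \<in> ball z0 r \<Longrightarrow> poly (p n) z \<noteq> 0"
    using nz unfolding eventually_sequentially by blast
  have "poly P z0 \<noteq> 0"
  proof (rule Hurwitz_no_zeros[where \<F> = "\<lambda>n. poly (p (n + N))" and g = "poly P"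
        and S = "ball z0 r"])
    show "uniform_limit K (\<lambda>n. poly (p (n + N))) (poly P) sequentially" if "compact K" "K \<subseteq> ball z0 r" for K
      by (rule uniform_limit_poly[OF p P LIMSEQ_ignore_initial_segment[OF lim]
            compact_imp_bounded[OF that(1)]])
    \<comment> \<open>If constant, \<open>poly P\<close> would be 0 on the ball because it vanishes
      at \<open>z0\<close>, but a nonzero polynomial has finitely many roots.\<close>
    show "\<not> poly P constant_on ball z0 r"
    proof
      assume "poly P constant_on ball z0 r"
      then have "ball z0 r \<subseteq> {z. poly P z = 0}"
        using zero r by (force simp: constant_on_def)
      moreover have "infinite (ball z0 r)"
        using r using finite_imp_not_open[of "ball z0 r"] by auto
      ultimately show False
        using poly_roots_finite[OF \<open>P \<noteq> 0\<close>] finite_subset by blast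
    qed
  qed (use N r in \<open>auto intro!: holomorphic_intros\<close>)
  then show False
    using zero by simp
qed

section \<open>Meromorphic functions are continuous into the sphere\<close>

lemma tendsto_sphere_val:
  assumes f: "f nicely_meromorphic_on D" and z: "z \<in> D"
  shows "(sphere_val f \<longlongrightarrow> sphere_val f z) (at z)"
proof (cases "is_pole f z")
  case True
  then have "filterlim f at_infinity (at z)"
    by (simp add: is_pole_def)
  then have inv: "((\<lambda>w. inverse (f w)) \<longlongrightarrow> 0) (at z)" and ne: "\<forall>\<^sub>F w in at z. f w \<noteq> 0"
    using filterlim_inverse_at_iff[of f "at z"] filterlim_at_infinity_imp_eventually_ne
    by (auto simp: filterlim_at)
  \<comment> \<open>If \<open>w\<close> is itself a pole, the left-hand side is 0; otherwise it is
    at most \<open>2 / cmod (f w)\<close>.\<close>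
  have "\<forall>\<^sub>F w in at z. dist (sphere_val f w) Infty \<le> norm (inverse (f w)) * 2"
    using ne
  proof eventually_elim
    case (elim w)
    have "cmod (f w) \<le> sqrt (1 + (cmod (f w))\<^sup>2)"
      by (rule real_le_rsqrt) auto
    then have "2 / sqrt (1 + (cmod (f w))\<^sup>2) \<le> 2 / cmod (f w)"
      using elim by (intro divide_left_mono mult_pos_pos) (auto intro: add_pos_nonneg)
    then show ?case
      by (auto simp: sphere_val_def dist_riemann_sphere norm_inverse divide_inverse)
  qed
  then have "((\<lambda>w. dist (sphere_val f w) Infty) \<longlongrightarrow> 0) (at z)"
    by (intro tendsto_0_le[OF inv, where K = 2]) (simp add: mult.commute)
  then show ?thesis
    using True tendsto_dist_iff[of "sphere_val f" Infty "at z"] by (simp add: sphere_val_def)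
next
  case False
  then have an: "f analytic_on {z}"
    using nicely_meromorphic_on_imp_analytic_at[OF f z] by simp
  then have lim: "((\<lambda>w. f w - f z) \<longlongrightarrow> 0) (at z)"
    using analytic_at_imp_isCont[OF an] by (simp add: isCont_def LIM_zero)
  have "isolated_singularity_at f z"
    using an by (rule isolated_singularity_at_analytic)
  \<comment> \<open>Poles are excluded near \<open>z\<close> so that \<open>sphere_val f w\<close>
    is \<open>Fin (f w)\<close> and the chordal distance is at most twice the Euclidean one.\<close>
  then have "\<forall>\<^sub>F w in at z. \<not> is_pole f w"
    by (rule eventually_not_pole)
  then have "\<forall>\<^sub>F w in at z. dist (sphere_val f w) (sphere_val f z) \<le> norm (f w - f z) * 2"
  proof eventually_elim
    case (elim w)
    have "1 * 1 \<le> sqrt (1 + (cmod (f w))\<^sup>2) * sqrt (1 + (cmod (f z))\<^sup>2)"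
      by (intro mult_mono) auto
    then have "2 * cmod (f w - f z) / (sqrt (1 + (cmod (f w))\<^sup>2) * sqrt (1 + (cmod (f z))\<^sup>2))
        \<le> 2 * cmod (f w - f z) / 1"
      by (intro divide_left_mono) auto
    then show ?case
      using elim False by (simp add: sphere_val_def dist_riemann_sphere)
  qed
  then have "((\<lambda>w. dist (sphere_val f w) (sphere_val f z)) \<longlongrightarrow> 0) (at z)"
    by (intro tendsto_0_le[OF lim, where K = 2]) simp
  then show ?thesis
    using tendsto_dist_iff by blast
qed

section \<open>Normalized fractions and compactness of their coefficients\<close>

lemma rational_fun_normalized:
  assumes "rational_fun d R" "d \<le> m"
  obtains p q where "degree p \<le> m" "degree q \<le> m"
    "\<And>z. poly p z \<noteq> 0 \<or> poly q z \<noteq> 0"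
    "\<And>z. sphere_val R z = ratio (poly p z) (poly q z)"
    "(\<Sum>i\<le>m. cmod (coeff p i) + cmod (coeff q i)) = 1"
proof -
  obtain p q where pq: "q \<noteq> 0" "coprime p q" "d = max (degree p) (degree q)"
    and R: "R = (\<lambda>z. poly p z / poly q z)"
    using assms(1) by (auto simp: rational_fun_def)
  define s where "s = (\<Sum>i\<le>m. cmod (coeff p i) + cmod (coeff q i))"
  \<comment> \<open>The leading coefficient of \<open>q\<close> is nonzero and its index is at most
    \<open>m\<close>, so the scaling factor \<open>1 / s\<close> makes sense.\<close>
  have "0 < cmod (coeff p (degree q)) + cmod (coeff q (degree q))"
    using pq(1) by (simp add: add_nonneg_pos)
  also have "\<dots> \<le> s"
    unfolding s_def using pq(3) assms(2)
    by (intro member_le_sum[where f = "\<lambda>i. cmod (coeff p i) + cmod (coeff q i)"]) auto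
  finally have s: "s > 0" .
  define c where "c = complex_of_real (1 / s)"
  have c: "c \<noteq> 0" "cmod c = 1 / s"
    using s by (auto simp: c_def norm_divide)
  show thesis
  proof (rule that[of "smult c p" "smult c q"])
    show "poly (smult c p) z \<noteq> 0 \<or> poly (smult c q) z \<noteq> 0" for z
      using coprime_poly_0[OF pq(2)] c by auto
    show "sphere_val R z = ratio (poly (smult c p) z) (poly (smult c q) z)" for z
      unfolding R sphere_val_rational[OF pq(1,2)] using c by (simp add: ratio_def)
    have "(\<Sum>i\<le>m. cmod (coeff (smult c p) i) + cmod (coeff (smult c q) i)) = cmod c * s"
      by (simp add: s_def norm_mult sum_distrib_left distrib_left)
    then show "(\<Sum>i\<le>m. cmod (coeff (smult c p) i) + cmod (coeff (smult c q) i)) = 1"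
      using c s by simp
  qed (use pq(3) assms(2) c in auto)
qed

lemma poly_convergent_subsequence:
  fixes p q :: "nat \<Rightarrow> complex poly"
  assumes p: "\<And>n. degree (p n) \<le> m" and q: "\<And>n. degree (q n) \<le> m"
    and one: "\<And>n. (\<Sum>i\<le>m. cmod (coeff (p n) i) + cmod (coeff (q n) i)) = 1"
  obtains k P Q where "strict_mono k" "degree P \<le> m" "degree Q \<le> m" "P \<noteq> 0 \<or> Q \<noteq> 0"
    "\<And>i. (\<lambda>n. coeff (p (k n)) i) \<longlonglongrightarrow> coeff P i"
    "\<And>i. (\<lambda>n. coeff (q (k n)) i) \<longlonglongrightarrow> coeff Q i"
proof -
  have bd: "norm (coeff (p n) i, coeff (q n) i) \<le> 1" for n i
  proof (cases "i \<le> m")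
    case True
    have "norm (coeff (p n) i, coeff (q n) i) \<le> cmod (coeff (p n) i) + cmod (coeff (q n) i)"
      by (rule norm_Pair_le)
    also have "\<dots> \<le> 1"
      unfolding one[of n, symmetric] using True
      by (intro member_le_sum[where f = "\<lambda>i. cmod (coeff (p n) i) + cmod (coeff (q n) i)"]) auto
    finally show ?thesis .
  next
    case False
    then show ?thesis
      using p[of n] q[of n] by (simp add: coeff_eq_0)
  qed
  \<comment> \<open>Diagonal extraction over all indices \<open>i\<close>; pairing the coefficients
    yields one subsequence that serves both \<open>p\<close> and \<open>q\<close>.\<close>
  obtain k where k: "strict_mono k"
    "\<And>i. i \<in> UNIV \<Longrightarrow> \<exists>l. (\<lambda>n. (coeff (p (k n)) i, coeff (q (k n)) i)) \<longlonglongrightarrow> l"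
    by (rule function_convergent_subsequence[of UNIV "\<lambda>n i. (coeff (p n) i, coeff (q n) i)" 1])
      (use bd in auto)
  then have "\<forall>i. \<exists>l. (\<lambda>n. (coeff (p (k n)) i, coeff (q (k n)) i)) \<longlonglongrightarrow> l"
    by blast
  from choice[OF this] obtain l
    where l: "\<And>i. (\<lambda>n. (coeff (p (k n)) i, coeff (q (k n)) i)) \<longlonglongrightarrow> l i"
    by blast
  have lp: "(\<lambda>n. coeff (p (k n)) i) \<longlonglongrightarrow> fst (l i)"
    and lq: "(\<lambda>n. coeff (q (k n)) i) \<longlonglongrightarrow> snd (l i)" for i
    using tendsto_fst[OF l[of i]] tendsto_snd[OF l[of i]] by simp_all
  have l0: "l i = (0, 0)" if "i > m" for i
  proof -
    have "coeff (p n) i = 0" "coeff (q n) i = 0" for n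
      using that p[of n] q[of n] by (simp_all add: coeff_eq_0)
    then show ?thesis
      using l[of i] LIMSEQ_unique[OF _ tendsto_const] by simp
  qed
  define P where "P = (\<Sum>i\<le>m. monom (fst (l i)) i)"
  define Q where "Q = (\<Sum>i\<le>m. monom (snd (l i)) i)"
  have cP: "coeff P i = fst (l i)" and cQ: "coeff Q i = snd (l i)" for i
    using l0[of i] by (auto simp: P_def Q_def coeff_sum not_le)
  \<comment> \<open>The normalization survives the limit, which prevents \<open>P\<close> and
    \<open>Q\<close> from both being 0.\<close>
  have "(\<lambda>n. \<Sum>i\<le>m. cmod (coeff (p (k n)) i) + cmod (coeff (q (k n)) i))
      \<longlonglongrightarrow> (\<Sum>i\<le>m. cmod (coeff P i) + cmod (coeff Q i))"
    unfolding cP cQ by (intro tendsto_intros lp lq)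
  then have "(\<Sum>i\<le>m. cmod (coeff P i) + cmod (coeff Q i)) = 1"
    unfolding one using LIMSEQ_unique[OF _ tendsto_const] by auto
  then have "P \<noteq> 0 \<or> Q \<noteq> 0"
    by auto
  moreover have "degree P \<le> m" "degree Q \<le> m"
    using l0 by (auto intro!: degree_le simp: cP cQ)
  ultimately show thesis
    using that k(1) lp lq by (simp add: cP cQ)
qed

section \<open>The limit function and spherical convergence to it\<close>

lemma nicely_meromorphic_ratio:
  fixes P Q :: "complex poly"
  assumes Q: "Q \<noteq> 0" and nz: "\<And>z. z \<in> D \<Longrightarrow> poly P z \<noteq> 0 \<or> poly Q z \<noteq> 0"
  obtains h where "h nicely_meromorphic_on D"
    "\<And>z. z \<in> D \<Longrightarrow> sphere_val h z = ratio (poly P z) (poly Q z)"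
proof -
  \<comment> \<open>\<open>P\<close> and \<open>Q\<close> may have acquired a common factor in the
    limit. Its zeros are common zeros of \<open>P\<close> and \<open>Q\<close>, hence lie outside
    \<open>D\<close>, and cancelling it keeps the values on \<open>D\<close>.\<close>
  define g where "g = gcd P Q"
  obtain P' Q' where P': "P = P' * g" and Q': "Q = Q' * g" and cop: "coprime P' Q'"
    using gcd_coprime_exists[of P Q] Q unfolding g_def by auto
  have Q'0: "Q' \<noteq> 0"
    using Q Q' by auto
  define h where "h = (\<lambda>z. poly P' z / poly Q' z)"
  show thesis
  proof (rule that[of h])
    have "rational_fun (max (degree P') (degree Q')) h"
      using cop Q'0 by (auto simp: rational_fun_def h_def)
    then show "h nicely_meromorphic_on D"
      by (rule rational_fun_nicely_meromorphic)
    show "sphere_val h z = ratio (poly P z) (poly Q z)" if "z \<in> D" for z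
    proof -
      have "poly g z \<noteq> 0"
        using nz[OF that] by (auto simp: P' Q')
      then show ?thesis
        unfolding h_def sphere_val_rational[OF Q'0 cop] by (simp add: ratio_def P' Q')
    qed
  qed
qed

text \<open>By compactness \<open>norm (poly P z, poly Q z)\<close> has a positive lower bound
  \<open>d\<close> on \<open>K\<close>, and \<open>dist_ratio_le\<close> then turns the errors of
  numerator and denominator into a uniform spherical error.\<close>

lemma uniform_limit_ratio:
  fixes p q :: "nat \<Rightarrow> complex poly"
  assumes p: "uniform_limit K (\<lambda>n. poly (p n)) (poly P) sequentially"
    and q: "uniform_limit K (\<lambda>n. poly (q n)) (poly Q) sequentially"
    and K: "compact K"
    and nz: "\<And>z n. poly (p n) z \<noteq> 0 \<or> poly (q n) z \<noteq> 0"
    and NZ: "\<And>z. z \<in> K \<Longrightarrow> poly P z \<noteq> 0 \<or> poly Q z \<noteq> 0"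
  shows "uniform_limit K (\<lambda>n z. ratio (poly (p n) z) (poly (q n) z))
           (\<lambda>z. ratio (poly P z) (poly Q z)) sequentially"
proof -
  obtain d where d: "d > 0" "\<And>z. z \<in> K \<Longrightarrow> d \<le> norm (poly P z, poly Q z)"
  proof (cases "K = {}")
    case True
    then show ?thesis
      using that[of 1] by simp
  next
    case False
    have "continuous_on K (\<lambda>z. norm (poly P z, poly Q z))"
      by (intro continuous_intros)
    from continuous_attains_inf[OF K False this]
    obtain x where x: "x \<in> K" "\<And>z. z \<in> K \<Longrightarrow> norm (poly P x, poly Q x) \<le> norm (poly P z, poly Q z)"
      by blast
    show ?thesis
      by (rule that[OF _ x(2)]) (use NZ[OF x(1)] in \<open>auto simp: zero_prod_def\<close>)
  qed
  show ?thesis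
  proof (rule uniform_limitI)
    fix e :: real assume "e > 0"
    \<comment> \<open>Two errors below \<open>e * d / 4\<close> add up to less than
      \<open>e * d / 2\<close>, and the factor \<open>2 / d\<close> of the estimate gives
      \<open>e\<close>.\<close>
    then have e: "e * d / 4 > 0"
      using d by simp
    show "\<forall>\<^sub>F n in sequentially. \<forall>z\<in>K.
        dist (ratio (poly (p n) z) (poly (q n) z)) (ratio (poly P z) (poly Q z)) < e"
      using uniform_limitD[OF p e] uniform_limitD[OF q e]
    proof eventually_elim
      case (elim n)
      show ?case
      proof
        fix z assume z: "z \<in> K"
        define s where "s = dist (poly (p n) z) (poly P z) + dist (poly (q n) z) (poly Q z)"
        have s: "s < e * d / 2" "s \<ge> 0"
          using elim z by (force simp: s_def)+
        have "dist (ratio (poly (p n) z) (poly (q n) z)) (ratio (poly P z) (poly Q z))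
            \<le> 2 * s / norm (poly P z, poly Q z)"
          unfolding s_def by (rule dist_ratio_le[OF nz NZ[OF z]])
        also have "\<dots> \<le> 2 * s / d"
          using d z s by (intro divide_left_mono) (auto intro: mult_pos_pos less_le_trans)
        also have "\<dots> < e"
          using s d by (simp add: divide_less_eq)
        finally show "dist (ratio (poly (p n) z) (poly (q n) z)) (ratio (poly P z) (poly Q z)) < e" .
      qed
    qed
  qed
qed

section \<open>Values omitted near a point\<close>

lemma eventually_omits:
  assumes lim: "spherically_locally_uniform_limit D f L" and D: "open D" and z0: "z0 \<in> D"
    and L: "(L \<longlongrightarrow> L z0) (at z0)" and a: "L z0 \<noteq> a"
  shows "\<exists>r>0. ball z0 r \<subseteq> D \<and> (\<forall>\<^sub>F n in sequentially. \<forall>z\<in>ball z0 r. sphere_val (f n) z \<noteq> a)"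
proof -
  \<comment> \<open>Half the distance: one \<open>e\<close> pays for the variation of
    \<open>L\<close> on the ball, the other for the distance from \<open>f n\<close> to
    \<open>L\<close>.\<close>
  define e where "e = dist (L z0) a / 2"
  have e: "e > 0"
    using a by (simp add: e_def)
  obtain U where U: "open U" "z0 \<in> U" "uniform_limit (U \<inter> D) (\<lambda>n. sphere_val (f n)) L sequentially"
    using lim z0 unfolding spherically_locally_uniform_limit_def by blast
  have "\<forall>\<^sub>F z in nhds z0. z \<in> U \<inter> D"
    using U D z0 by (intro eventually_nhds_in_open) auto
  moreover have "\<forall>\<^sub>F z in nhds z0. dist (L z) (L z0) < e"
    using tendstoD[OF L e] e by (auto simp: eventually_at_filter elim: eventually_mono)
  ultimately have "\<forall>\<^sub>F z in nhds z0. z \<in> U \<inter> D \<and> dist (L z) (L z0) < e"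
    by (rule eventually_conj)
  then obtain r where r: "r > 0" "\<And>z. z \<in> ball z0 r \<Longrightarrow> z \<in> U \<inter> D \<and> dist (L z) (L z0) < e"
    unfolding eventually_nhds_metric by (auto simp: dist_commute)
  have "\<forall>\<^sub>F n in sequentially. \<forall>z\<in>ball z0 r. sphere_val (f n) z \<noteq> a"
    using uniform_limitD[OF U(3) e]
  proof eventually_elim
    case (elim n)
    show ?case
    proof
      fix z assume z: "z \<in> ball z0 r"
      have "dist (L z0) a \<le> dist (sphere_val (f n) z) (L z) + dist (L z) (L z0) + dist (sphere_val (f n) z) a"
        by metric
      moreover have "dist (sphere_val (f n) z) (L z) < e" "dist (L z) (L z0) < e"
        using elim r(2)[OF z] by auto
      ultimately show "sphere_val (f n) z \<noteq> a"
        by (auto simp: e_def)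
    qed
  qed
  then show ?thesis
    using r by blast
qed

section \<open>Normality of the family of rational functions\<close>

theorem theorem1p5:
  fixes D :: "complex set" and m :: nat
    and \<R> \<G> :: "(complex \<Rightarrow> complex) set"
    and a1 a2 a3 :: riemann_sphere
  assumes "open D" and "connected D" and "D \<noteq> {}"
    and "\<forall>R\<in>\<R>. \<exists>d\<le>m. rational_fun d R"
    and "\<forall>g\<in>\<G>. g nicely_meromorphic_on D"
    and "a1 \<noteq> a2" and "a1 \<noteq> a3" and "a2 \<noteq> a3"
    and "normal_family D \<G>"
    and "\<forall>R\<in>\<R>. \<exists>g\<in>\<G>. \<forall>a\<in>{a1, a2, a3}. shares_partially D R g a"
  shows "normal_family D \<R>"
  unfolding normal_family_def
proof (intro allI impI)
  fix f :: "nat \<Rightarrow> complex \<Rightarrow> complex"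
  assume f: "range f \<subseteq> \<R>"
  then have "\<forall>n. \<exists>g\<in>\<G>. \<forall>a\<in>{a1, a2, a3}. shares_partially D (f n) g a"
    using assms(10) by blast
  then obtain g where g: "\<And>n. g n \<in> \<G>"
    and share: "\<And>n a. a \<in> {a1, a2, a3} \<Longrightarrow> shares_partially D (f n) (g n) a"
    by metis
  obtain r L where r: "strict_mono r" and L: "spherically_locally_uniform_limit D (g \<circ> r) L"
    and L_cases: "(\<exists>h. h nicely_meromorphic_on D \<and> (\<forall>z\<in>D. L z = sphere_val h z)) \<or> (\<forall>z\<in>D. L z = Infty)"
    using assms(9) g unfolding normal_family_def by (metis image_subsetI)
  \<comment> \<open>The limit is \<open>Infty\<close> throughout \<open>D\<close> or meromorphic
    there, and continuous either way. It agrees with \<open>h\<close> only on \<open>D\<close>,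
    which contains a neighbourhood of \<open>z\<close>.\<close>
  have L_cont: "(L \<longlongrightarrow> L z) (at z)" if z: "z \<in> D" for z
  proof -
    obtain h where h: "(h \<longlongrightarrow> h z) (at z)" "\<And>w. w \<in> D \<Longrightarrow> L w = h w"
    proof (cases "\<forall>w\<in>D. L w = Infty")
      case True
      show ?thesis
        by (rule that[of "\<lambda>_. Infty"]) (use True in auto)
    next
      case False
      then obtain h where "h nicely_meromorphic_on D" "\<forall>w\<in>D. L w = sphere_val h w"
        using L_cases by blast
      then show ?thesis
        using that[of "sphere_val h"] tendsto_sphere_val[OF _ z] by blast
    qed
    have "\<forall>\<^sub>F w in at z. L w = h w"
      using h(2) eventually_at_in_open'[OF assms(1) z] by (auto elim: eventually_mono)
    then show ?thesis
      using h z tendsto_cong[of L h "at z" "h z"] by simp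
  qed
  define repr where "repr n p q \<longleftrightarrow> degree p \<le> m \<and> degree q \<le> m
      \<and> (\<forall>z. poly p z \<noteq> 0 \<or> poly q z \<noteq> 0)
      \<and> (\<forall>z. sphere_val (f (r n)) z = ratio (poly p z) (poly q z))
      \<and> (\<Sum>i\<le>m. cmod (coeff p i) + cmod (coeff q i)) = 1" for n p q
  have "\<exists>p q. repr n p q" for n
  proof -
    obtain d where d: "rational_fun d (f (r n))" "d \<le> m"
      using f assms(4) by blast
    show ?thesis
      unfolding repr_def by (rule rational_fun_normalized[OF d]) blast
  qed
  then obtain p q where "\<And>n. repr n (p n) (q n)"
    by metis
  then have deg: "\<And>n. degree (p n) \<le> m" "\<And>n. degree (q n) \<le> m"
    and nz: "\<And>n z. poly (p n) z \<noteq> 0 \<or> poly (q n) z \<noteq> 0"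
    and val: "\<And>n z. sphere_val (f (r n)) z = ratio (poly (p n) z) (poly (q n) z)"
    and one: "\<And>n. (\<Sum>i\<le>m. cmod (coeff (p n) i) + cmod (coeff (q n) i)) = 1"
    by (simp_all add: repr_def)
  obtain k P Q where k: "strict_mono k" and degPQ: "degree P \<le> m" "degree Q \<le> m"
    and PQ: "P \<noteq> 0 \<or> Q \<noteq> 0"
    and lim: "\<And>i. (\<lambda>n. coeff (p (k n)) i) \<longlonglongrightarrow> coeff P i" "\<And>i. (\<lambda>n. coeff (q (k n)) i) \<longlonglongrightarrow> coeff Q i"
    by (rule poly_convergent_subsequence[of p m q, OF deg one]) (rule that, assumption+)
  have NZ: "poly P z0 \<noteq> 0 \<or> poly Q z0 \<noteq> 0" if z0: "z0 \<in> D" for z0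
  proof (rule ccontr)
    assume "\<not> ?thesis"
    then have zero: "poly (omission_poly a P Q) z0 = 0" for a
      by (cases a) auto
    have vanish: "omission_poly a P Q = 0" if a: "a \<in> {a1, a2, a3}" "L z0 \<noteq> a" for a
    proof -
      obtain \<rho> where \<rho>: "\<rho> > 0" "ball z0 \<rho> \<subseteq> D"
        "\<forall>\<^sub>F n in sequentially. \<forall>z\<in>ball z0 \<rho>. sphere_val ((g \<circ> r) n) z \<noteq> a"
        using eventually_omits[OF L assms(1) z0 L_cont[OF z0] a(2)] by blast
      have "\<forall>\<^sub>F n in sequentially. \<forall>z\<in>ball z0 \<rho>. sphere_val ((g \<circ> r) (k n)) z \<noteq> a"
        by (rule eventually_subseq[OF k \<rho>(3)])
      then have omit: "\<forall>\<^sub>F n in sequentially. \<forall>z\<in>ball z0 \<rho>. poly (omission_poly a (p (k n)) (q (k n))) z \<noteq> 0"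
      proof eventually_elim
        case (elim n)
        show ?case
        proof
          fix z assume z: "z \<in> ball z0 \<rho>"
          \<comment> \<open>Contrapositive of partial sharing: a value omitted by the associated
            member of \<open>\<G>\<close> on a ball inside \<open>D\<close> is omitted there by the
            rational function.\<close>
          then have "sphere_val (f (r (k n))) z \<noteq> a"
            using elim z \<rho>(2) share[OF a(1), of "r (k n)"]
            unfolding shares_partially_def comp_apply by blast
          then show "poly (omission_poly a (p (k n)) (q (k n))) z \<noteq> 0"
            using ratio_eq_iff_omission_poly[OF nz] by (simp add: val)
        qed
      qed
      show ?thesis
        by (rule Hurwitz_poly[OF degree_omission_poly_le[OF deg] degree_omission_poly_le[OF degPQ]
              tendsto_coeff_omission_poly[OF lim] omit \<rho>(1) zero])
    qed
    \<comment> \<open>At most one of the three distinct values equals \<open>L z0\<close>.\<close>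
    obtain a b where "a \<in> {a1, a2, a3}" "b \<in> {a1, a2, a3}" "a \<noteq> b" "L z0 \<noteq> a" "L z0 \<noteq> b"
      using assms(6-8) by (metis insertCI)
    then show False
      using omission_poly_zero_imp[of a b P Q] vanish PQ by blast
  qed
  define M where "M z = ratio (poly P z) (poly Q z)" for z
  have "spherically_locally_uniform_limit D (f \<circ> (r \<circ> k)) M"
    unfolding spherically_locally_uniform_limit_def
  proof
    fix z assume "z \<in> D"
    then obtain \<rho> where \<rho>: "\<rho> > 0" "cball z \<rho> \<subseteq> D"
      using assms(1) open_contains_cball by blast
    have "uniform_limit (cball z \<rho>) (\<lambda>n. sphere_val ((f \<circ> (r \<circ> k)) n)) M sequentially"
      unfolding M_def comp_apply val
      by (intro uniform_limit_ratio uniform_limit_poly[OF deg(1) degPQ(1) lim(1)]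
          uniform_limit_poly[OF deg(2) degPQ(2) lim(2)] nz NZ) (use \<rho> in auto)
    then have "uniform_limit (ball z \<rho> \<inter> D) (\<lambda>n. sphere_val ((f \<circ> (r \<circ> k)) n)) M sequentially"
      by (rule uniform_limit_on_subset) auto
    then show "\<exists>U. open U \<and> z \<in> U \<and> uniform_limit (U \<inter> D) (\<lambda>n. sphere_val ((f \<circ> (r \<circ> k)) n)) M sequentially"
      using \<rho> by (intro exI[of _ "ball z \<rho>"]) auto
  qed
  moreover have "(\<exists>h. h nicely_meromorphic_on D \<and> (\<forall>z\<in>D. M z = sphere_val h z)) \<or> (\<forall>z\<in>D. M z = Infty)"
  \<comment> \<open>The denominators may tend to 0; this is the case of a limit identically
    \<open>Infty\<close>.\<close>
  proof (cases "Q = 0")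
    case True
    then show ?thesis
      by (simp add: M_def ratio_def)
  next
    case False
    then show ?thesis
      using nicely_meromorphic_ratio[OF False NZ] unfolding M_def by metis
  qed
  ultimately show "\<exists>r L. strict_mono r \<and> spherically_locally_uniform_limit D (f \<circ> r) L \<and>
      ((\<exists>h. h nicely_meromorphic_on D \<and> (\<forall>z\<in>D. L z = sphere_val h z)) \<or> (\<forall>z\<in>D. L z = Infty))"
    using strict_mono_o[OF r k] by blast
qed

end
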